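(* Let $n\ge1$ and let $\operatorname{aff}:[n]\to[n]$ be any map. Then both lattices $\Pi^{\exists}_{\operatorname{aff}}$ and $\Pi^{\forall}_{\operatorname{aff}}$ are comodernistic.
   Context: $\Pi_n$ is the lattice of set partitions of $[n]=\{1,\dots,n\}$ ordered by refinement. Define $\Pi^{\forall}_{\operatorname{aff}}=\{\pi\in\Pi_n: \text{every non-singleton block } B \text{ of } \pi \text{ has } |B|\ge\operatorname{aff}(x) \text{ for every } x\in B\}$ and $\Pi^{\exists}_{\operatorname{aff}}=\{\pi\in\Pi_n: \text{every non-singleton block } B \text{ of } \pi \text{ contains some } x \text{ with } |B|\ge\operatorname{aff}(x)\}$, ordered as subposets of $\Pi_n$ (they are join subsemilattices of $\Pi_n$, hence lattices). An element $m$ of a lattice $L$ is left-modular if $(x\vee m)\wedge y=x\vee(m\wedge y)$ for all $x<y$; a lattice is comodernistic if every interval $[u,v]$ has a coatom that is left-modular in $[u,v]$. *)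

theory Defs
  imports "HOL-Algebra.Lattice" "HOL-Library.Disjoint_Sets"
begin

definition subposet :: "('a, 'b) gorder_scheme \<Rightarrow> 'a set \<Rightarrow> ('a, 'b) gorder_scheme" where
  "subposet L A = L\<lparr>carrier := A\<rparr>"

definition coatom :: "('a, 'b) gorder_scheme \<Rightarrow> 'a \<Rightarrow> bool" where
  "coatom L m \<longleftrightarrow> m \<in> carrier L \<and> m \<sqsubset>\<^bsub>L\<^esub> \<top>\<^bsub>L\<^esub> \<and>
     \<not> (\<exists>z\<in>carrier L. m \<sqsubset>\<^bsub>L\<^esub> z \<and> z \<sqsubset>\<^bsub>L\<^esub> \<top>\<^bsub>L\<^esub>)"

definition left_modular :: "('a, 'b) gorder_scheme \<Rightarrow> 'a \<Rightarrow> bool" where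
  "left_modular L m \<longleftrightarrow> m \<in> carrier L \<and>
     (\<forall>x\<in>carrier L. \<forall>y\<in>carrier L. x \<sqsubset>\<^bsub>L\<^esub> y \<longrightarrow>
        (x \<squnion>\<^bsub>L\<^esub> m) \<sqinter>\<^bsub>L\<^esub> y = x \<squnion>\<^bsub>L\<^esub> (m \<sqinter>\<^bsub>L\<^esub> y))"

(* Only intervals with u < v are considered: a one-element interval has no coatom at all. *)
definition comodernistic :: "('a, 'b) gorder_scheme \<Rightarrow> bool" where
  "comodernistic L \<longleftrightarrow> lattice L \<and>
     (\<forall>u\<in>carrier L. \<forall>v\<in>carrier L. u \<sqsubset>\<^bsub>L\<^esub> v \<longrightarrow>
        (\<exists>m. coatom (subposet L \<lbrace>u..v\<rbrace>\<^bsub>L\<^esub>) m \<and> left_modular (subposet L \<lbrace>u..v\<rbrace>\<^bsub>L\<^esub>) m))"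

definition partition_lattice :: "nat \<Rightarrow> nat set set gorder" where
  "partition_lattice n =
     \<lparr>carrier = {\<pi>. partition_on {1..n} \<pi>}, eq = (=), le = refines {1..n}\<rparr>"

definition Pi_forall :: "nat \<Rightarrow> (nat \<Rightarrow> nat) \<Rightarrow> nat set set gorder" where
  "Pi_forall n aff = subposet (partition_lattice n)
     {\<pi> \<in> carrier (partition_lattice n).
        \<forall>B\<in>\<pi>. card B \<noteq> 1 \<longrightarrow> (\<forall>x\<in>B. card B \<ge> aff x)}"

definition Pi_exists :: "nat \<Rightarrow> (nat \<Rightarrow> nat) \<Rightarrow> nat set set gorder" where
  "Pi_exists n aff = subposet (partition_lattice n)
     {\<pi> \<in> carrier (partition_lattice n).
        \<forall>B\<in>\<pi>. card B \<noteq> 1 \<longrightarrow> (\<exists>x\<in>B. card B \<ge> aff x)}"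

end

theory Submission
  imports Defs
begin

text \<open>
  Call a block valid if it is allowed in a partition of the lattice: singletons are valid, and so is
  the union of two intersecting valid blocks.  Hence the valid subsets common to blocks of any given
  partitions have maximal members that again form a partition, which is the meet.

  In an interval \<open>[u,v]\<close> choose a block \<open>B\<close> of \<open>v\<close> that is not a block of \<open>u\<close>, and a block \<open>U \<subset> B\<close> of
  \<open>u\<close>: a singleton \<open>{a}\<close> with \<open>aff a\<close> maximal if \<open>B\<close> contains singleton blocks of \<open>u\<close>, and an arbitrary
  one otherwise.  The left-modular coatom \<open>m\<close> is the greatest element below \<open>v\<close> having \<open>U\<close> as a
  block.  If \<open>x \<le> y\<close> and \<open>x\<close> is not below \<open>m\<close>, then the blocks \<open>X \<subseteq> Y\<close> of \<open>x\<close> and \<open>y\<close> around \<open>U\<close>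
  satisfy \<open>U \<subset> X\<close>; if moreover \<open>X \<subset> Y\<close>, the choice of \<open>U\<close> makes \<open>Y - U\<close> valid, so \<open>m \<sqinter> y\<close> only splits
  \<open>U\<close> off from \<open>Y\<close> and \<open>x \<squnion> (m \<sqinter> y) = y\<close>.
\<close>

section \<open>Lattices, intervals, and a criterion for left-modular coatoms\<close>

lemma carrier_subposet [simp]: "carrier (subposet L A) = A"
  and le_subposet [simp]: "le (subposet L A) = le L"
  and eq_subposet [simp]: "eq (subposet L A) = eq L"
  by (simp_all add: subposet_def)

lemma partial_orderI_equality:
  assumes "eq L = (=)"
    and "\<And>x. x \<in> carrier L \<Longrightarrow> x \<sqsubseteq>\<^bsub>L\<^esub> x"
    and "\<And>x y. x \<sqsubseteq>\<^bsub>L\<^esub> y \<Longrightarrow> y \<sqsubseteq>\<^bsub>L\<^esub> x \<Longrightarrow> x \<in> carrier L \<Longrightarrow> y \<in> carrier L \<Longrightarrow> x = y"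
    and "\<And>x y z. x \<sqsubseteq>\<^bsub>L\<^esub> y \<Longrightarrow> y \<sqsubseteq>\<^bsub>L\<^esub> z \<Longrightarrow> x \<in> carrier L \<Longrightarrow> y \<in> carrier L \<Longrightarrow> z \<in> carrier L \<Longrightarrow> x \<sqsubseteq>\<^bsub>L\<^esub> z"
  shows "partial_order L"
proof
  show "x \<sqsubseteq>\<^bsub>L\<^esub> z" if "x \<sqsubseteq>\<^bsub>L\<^esub> y" "y \<sqsubseteq>\<^bsub>L\<^esub> z" "x \<in> carrier L" "y \<in> carrier L" "z \<in> carrier L" for x y z
    using assms(4) that .
qed (simp_all add: assms(1-3))

lemma latticeI_bounds:
  assumes "partial_order L"
    and sup: "\<And>x y. x \<in> carrier L \<Longrightarrow> y \<in> carrier L \<Longrightarrow>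
       \<exists>s\<in>carrier L. x \<sqsubseteq>\<^bsub>L\<^esub> s \<and> y \<sqsubseteq>\<^bsub>L\<^esub> s \<and> (\<forall>z\<in>carrier L. x \<sqsubseteq>\<^bsub>L\<^esub> z \<longrightarrow> y \<sqsubseteq>\<^bsub>L\<^esub> z \<longrightarrow> s \<sqsubseteq>\<^bsub>L\<^esub> z)"
    and inf: "\<And>x y. x \<in> carrier L \<Longrightarrow> y \<in> carrier L \<Longrightarrow>
       \<exists>s\<in>carrier L. s \<sqsubseteq>\<^bsub>L\<^esub> x \<and> s \<sqsubseteq>\<^bsub>L\<^esub> y \<and> (\<forall>z\<in>carrier L. z \<sqsubseteq>\<^bsub>L\<^esub> x \<longrightarrow> z \<sqsubseteq>\<^bsub>L\<^esub> y \<longrightarrow> z \<sqsubseteq>\<^bsub>L\<^esub> s)"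
  shows "lattice L"
proof -
  interpret partial_order L by fact
  show ?thesis
  proof unfold_locales
    fix x y assume xy: "x \<in> carrier L" "y \<in> carrier L"
    show "\<exists>s. least L s (Upper L {x, y})"
      using sup[OF xy] xy by (auto simp: least_def Upper_def)
    show "\<exists>s. greatest L s (Lower L {x, y})"
      using inf[OF xy] xy by (auto simp: greatest_def Lower_def)
  qed
qed

text \<open>Joins and meets taken in \<open>L\<close> of two elements of the interval do not leave
  it, so they are least upper and greatest lower bounds there too.\<close>

lemma lattice_interval:
  fixes L (structure)
  assumes "lattice L" and uv: "u \<in> carrier L" "v \<in> carrier L"
  shows "lattice (subposet L \<lbrace>u..v\<rbrace>\<^bsub>L\<^esub>)" (is "lattice ?I")
proof -
  interpret lattice L by fact
  have po: "partial_order ?I"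
    by (rule partial_orderI_equality)
      (auto simp: at_least_at_most_def eq_is_equal intro: le_antisym le_trans)
  show ?thesis
  proof (rule latticeI_bounds[OF po])
    fix x y assume "x \<in> carrier ?I" "y \<in> carrier ?I"
    then have xy: "x \<in> carrier L" "y \<in> carrier L" "u \<sqsubseteq> x" "x \<sqsubseteq> v" "u \<sqsubseteq> y" "y \<sqsubseteq> v"
      by (auto simp: at_least_at_most_def)
    have "u \<sqsubseteq> x \<squnion> y" "x \<sqinter> y \<sqsubseteq> v"
      using le_trans[OF xy(3) join_left] le_trans[OF meet_left xy(4)] xy uv by auto
    then have mem: "x \<squnion> y \<in> carrier ?I" "x \<sqinter> y \<in> carrier ?I"
      using xy uv by (auto simp: at_least_at_most_def join_le meet_le)
    show "\<exists>s\<in>carrier ?I. x \<sqsubseteq>\<^bsub>?I\<^esub> s \<and> y \<sqsubseteq>\<^bsub>?I\<^esub> s \<and>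
        (\<forall>z\<in>carrier ?I. x \<sqsubseteq>\<^bsub>?I\<^esub> z \<longrightarrow> y \<sqsubseteq>\<^bsub>?I\<^esub> z \<longrightarrow> s \<sqsubseteq>\<^bsub>?I\<^esub> z)"
      using xy mem(1)
      by (intro bexI[of _ "x \<squnion> y"]) (auto simp: at_least_at_most_def join_left join_right join_le)
    show "\<exists>s\<in>carrier ?I. s \<sqsubseteq>\<^bsub>?I\<^esub> x \<and> s \<sqsubseteq>\<^bsub>?I\<^esub> y \<and>
        (\<forall>z\<in>carrier ?I. z \<sqsubseteq>\<^bsub>?I\<^esub> x \<longrightarrow> z \<sqsubseteq>\<^bsub>?I\<^esub> y \<longrightarrow> z \<sqsubseteq>\<^bsub>?I\<^esub> s)"
      using xy mem(2)
      by (intro bexI[of _ "x \<sqinter> y"]) (auto simp: at_least_at_most_def meet_left meet_right meet_le)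
  qed
qed

text \<open>Both properties come from \<open>split\<close>, whose witness \<open>w\<close> lies
  below the meet of \<open>m\<close> and \<open>y\<close>: if \<open>x\<close> is not below
  \<open>m\<close>, then joining \<open>x\<close> with that meet already gives all of
  \<open>y\<close>. In the modular law both sides are the meet of \<open>m\<close> and
  \<open>y\<close> when \<open>x\<close> is below \<open>m\<close>, and both are \<open>y\<close>
  otherwise.\<close>

lemma left_modular_coatomI:
  assumes "lattice I" and v: "v \<in> carrier I" "\<And>x. x \<in> carrier I \<Longrightarrow> x \<sqsubseteq>\<^bsub>I\<^esub> v"
    and m: "m \<in> carrier I" "m \<noteq> v"
    and split: "\<And>x y. x \<in> carrier I \<Longrightarrow> y \<in> carrier I \<Longrightarrow> x \<sqsubseteq>\<^bsub>I\<^esub> y \<Longrightarrow> \<not> x \<sqsubseteq>\<^bsub>I\<^esub> m \<Longrightarrow>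
      \<exists>w\<in>carrier I. w \<sqsubseteq>\<^bsub>I\<^esub> m \<and> w \<sqsubseteq>\<^bsub>I\<^esub> y \<and>
        (\<forall>z\<in>carrier I. x \<sqsubseteq>\<^bsub>I\<^esub> z \<longrightarrow> w \<sqsubseteq>\<^bsub>I\<^esub> z \<longrightarrow> y \<sqsubseteq>\<^bsub>I\<^esub> z)"
  shows "coatom I m \<and> left_modular I m"
proof -
  interpret lattice I by fact
  have "greatest I v (carrier I)" using v by (simp add: greatest_def)
  \<comment> \<open>The top is defined by a choice of a greatest element, so uniqueness identifies
    it with \<open>v\<close>.\<close>
  then have top: "\<top>\<^bsub>I\<^esub> = v"
    unfolding top_def by (metis (mono_tags, lifting) greatest_unique someI)
  \<comment> \<open>This is \<open>split\<close> with \<open>y = v\<close>. Taking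
    \<open>x = z\<close> makes \<open>m\<close> a coatom; taking \<open>z\<close> to be the join of
    \<open>x\<close> and \<open>m\<close> shows that this join is the top.\<close>
  have above_m: "v \<sqsubseteq>\<^bsub>I\<^esub> z" if z: "z \<in> carrier I" "x \<in> carrier I" "x \<sqsubseteq>\<^bsub>I\<^esub> z" "m \<sqsubseteq>\<^bsub>I\<^esub> z" "\<not> x \<sqsubseteq>\<^bsub>I\<^esub> m" for x z
    using split[OF z(2) v(1) v(2)[OF z(2)] z(5)] z m(1) le_trans by blast
  have "coatom I m"
    unfolding coatom_def top lless_def eq_is_equal
    using m v above_m by (metis le_antisym le_refl)
  moreover have "(x \<squnion>\<^bsub>I\<^esub> m) \<sqinter>\<^bsub>I\<^esub> y = x \<squnion>\<^bsub>I\<^esub> (m \<sqinter>\<^bsub>I\<^esub> y)"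
    if x: "x \<in> carrier I" and y: "y \<in> carrier I" and xy: "x \<sqsubseteq>\<^bsub>I\<^esub> y" for x y
  proof (cases "x \<sqsubseteq>\<^bsub>I\<^esub> m")
    case True
    then have "x \<squnion>\<^bsub>I\<^esub> m = m"
      using x m by (meson join_closed join_le join_right le_antisym le_refl)
    moreover have "x \<sqsubseteq>\<^bsub>I\<^esub> m \<sqinter>\<^bsub>I\<^esub> y" using True xy x y m by (simp add: meet_le)
    then have "x \<squnion>\<^bsub>I\<^esub> (m \<sqinter>\<^bsub>I\<^esub> y) = m \<sqinter>\<^bsub>I\<^esub> y"
      using x y m by (meson join_closed join_le join_right le_antisym le_refl meet_closed)
    ultimately show ?thesis by simp
  next
    case False
    have "v \<sqsubseteq>\<^bsub>I\<^esub> x \<squnion>\<^bsub>I\<^esub> m"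
      using above_m[of "x \<squnion>\<^bsub>I\<^esub> m" x] x m False by (simp add: join_left join_right)
    then have "y \<sqsubseteq>\<^bsub>I\<^esub> x \<squnion>\<^bsub>I\<^esub> m" using le_trans v x y m by (meson join_closed)
    then have 1: "(x \<squnion>\<^bsub>I\<^esub> m) \<sqinter>\<^bsub>I\<^esub> y = y"
      using x y m by (meson join_closed le_antisym le_refl meet_closed meet_le meet_right)
    obtain w where w: "w \<in> carrier I" "w \<sqsubseteq>\<^bsub>I\<^esub> m" "w \<sqsubseteq>\<^bsub>I\<^esub> y"
      "\<forall>z\<in>carrier I. x \<sqsubseteq>\<^bsub>I\<^esub> z \<longrightarrow> w \<sqsubseteq>\<^bsub>I\<^esub> z \<longrightarrow> y \<sqsubseteq>\<^bsub>I\<^esub> z"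
      using split[OF x y xy False] by blast
    let ?j = "x \<squnion>\<^bsub>I\<^esub> (m \<sqinter>\<^bsub>I\<^esub> y)"
    have j: "?j \<in> carrier I" using x y m by simp
    have "w \<sqsubseteq>\<^bsub>I\<^esub> m \<sqinter>\<^bsub>I\<^esub> y" using w y m by (simp add: meet_le)
    moreover have "m \<sqinter>\<^bsub>I\<^esub> y \<sqsubseteq>\<^bsub>I\<^esub> ?j" using x y m by (simp add: join_right)
    ultimately have "w \<sqsubseteq>\<^bsub>I\<^esub> ?j" using le_trans w(1) y m j by (meson meet_closed)
    then have "y \<sqsubseteq>\<^bsub>I\<^esub> ?j" using w(4) j x y m by (simp add: join_left)
    moreover have "?j \<sqsubseteq>\<^bsub>I\<^esub> y" using x y m xy by (simp add: join_le meet_right)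
    ultimately have "?j = y" using j y le_antisym by blast
    with 1 show ?thesis by simp
  qed
  ultimately show ?thesis
    using m by (auto simp: left_modular_def lless_def)
qed

section \<open>Partitions, refinement, and systems of valid blocks\<close>

lemma maximal_members_partition:
  assumes "finite A" and F: "F \<subseteq> Pow A" "{} \<notin> F" "\<And>a. a \<in> A \<Longrightarrow> {a} \<in> F"
    and union: "\<And>C D. C \<in> F \<Longrightarrow> D \<in> F \<Longrightarrow> C \<inter> D \<noteq> {} \<Longrightarrow> C \<union> D \<in> F"
  obtains \<pi> where "partition_on A \<pi>" "\<pi> \<subseteq> F" "\<forall>C\<in>F. \<exists>D\<in>\<pi>. C \<subseteq> D"
proof
  \<comment> \<open>Inclusion-maximal members: finiteness puts every member of \<open>F\<close>
    below one of them, the singletons make them cover \<open>A\<close>, and two that intersect both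
    equal their union.\<close>
  let ?M = "{C \<in> F. \<forall>D\<in>F. C \<subseteq> D \<longrightarrow> C = D}"
  have "finite F" using assms(1) F(1) by (meson finite_Pow_iff finite_subset)
  then have below: "\<exists>D\<in>?M. C \<subseteq> D" if "C \<in> F" for C
    using finite_has_maximal2[of F C] that by auto
  then show "\<forall>C\<in>F. \<exists>D\<in>?M. C \<subseteq> D" by blast
  show "?M \<subseteq> F" by blast
  show "partition_on A ?M"
  proof (rule partition_onI)
    show "\<Union>?M = A"
    proof
      show "\<Union>?M \<subseteq> A" using F(1) by blast
      show "A \<subseteq> \<Union>?M" using below[OF F(3)] by blast
    qed
    show "disjnt p q" if "p \<in> ?M" "q \<in> ?M" "p \<noteq> q" for p q
    proof (rule ccontr)
      assume "\<not> disjnt p q"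
      then have "p \<union> q \<in> F" using union that by (auto simp: disjnt_def)
      then have "p = p \<union> q" using that(1) by simp
      moreover have "q = p \<union> q" using that(2) \<open>p \<union> q \<in> F\<close> by simp
      ultimately show False using that(3) by metis
    qed
    show "{} \<notin> ?M" using F(2) by blast
  qed
qed

lemma partition_on_same_block:
  assumes "partition_on A \<pi>" "B \<in> \<pi>" "C \<in> \<pi>" "B \<inter> C \<noteq> {}"
  shows "B = C"
  using assms by (auto simp: partition_on_def disjoint_def)

lemma refines_subset_block:
  assumes "refines A P Q" "B \<in> P" "C \<subseteq> B"
  shows "\<exists>D\<in>Q. C \<subseteq> D"
proof -
  obtain D where "D \<in> Q" "B \<subseteq> D" using assms(1,2) by (auto simp: refines_def)
  with assms(3) show ?thesis by blast
qed

text \<open>\<open>V\<close> is validity of a block. In \<open>removable\<close>,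
  \<open>\<U>\<close> stands for the blocks of \<open>u\<close> inside a block \<open>B\<close> of
  \<open>v\<close>, and \<open>X \<subset> \<Union>\<Y>\<close> for blocks of elements
  \<open>x\<close> below \<open>y\<close> of the interval. A single \<open>U\<close> must serve all
  such pairs, since the coatom is fixed before \<open>x\<close> and \<open>y\<close> are
  given.\<close>

locale block_system =
  fixes A :: "'a set" and V :: "'a set \<Rightarrow> bool"
  assumes finite_ground: "finite A"
    and valid_singleton: "a \<in> A \<Longrightarrow> V {a}"
    and valid_union: "S \<subseteq> A \<Longrightarrow> T \<subseteq> A \<Longrightarrow> V S \<Longrightarrow> V T \<Longrightarrow> S \<inter> T \<noteq> {} \<Longrightarrow> V (S \<union> T)"
    and removable: "B \<subseteq> A \<Longrightarrow> B \<noteq> {} \<Longrightarrow> partition_on B \<U> \<Longrightarrow> (\<And>W. W \<in> \<U> \<Longrightarrow> V W) \<Longrightarrow>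
      \<exists>U\<in>\<U>. \<forall>\<Y> X. \<Y> \<subseteq> \<U> \<longrightarrow> U \<subset> X \<longrightarrow> X \<subset> \<Union>\<Y> \<longrightarrow> V X \<longrightarrow> V (\<Union>\<Y>) \<longrightarrow> V (\<Union>\<Y> - U)"
begin

section \<open>The lattice of partitions into valid blocks\<close>

definition block_poset :: "'a set set gorder" where
  "block_poset = \<lparr>carrier = {\<pi>. partition_on A \<pi> \<and> (\<forall>B\<in>\<pi>. V B)}, eq = (=), le = refines A\<rparr>"

lemma carrier_block_poset: "\<pi> \<in> carrier block_poset \<longleftrightarrow> partition_on A \<pi> \<and> (\<forall>B\<in>\<pi>. V B)"
  and le_block_poset [simp]: "le block_poset = refines A"
  and eq_block_poset [simp]: "eq block_poset = (=)"
  by (simp_all add: block_poset_def)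

lemma greatest_common_refinement:
  assumes S: "\<And>\<pi>. \<pi> \<in> S \<Longrightarrow> partition_on A \<pi>"
  obtains g where "g \<in> carrier block_poset" "\<forall>\<pi>\<in>S. refines A g \<pi>"
    "\<forall>C\<subseteq>A. C \<noteq> {} \<longrightarrow> V C \<longrightarrow> (\<forall>\<pi>\<in>S. \<exists>B\<in>\<pi>. C \<subseteq> B) \<longrightarrow> (\<exists>D\<in>g. C \<subseteq> D)"
proof -
  define F where "F = {C. C \<subseteq> A \<and> C \<noteq> {} \<and> V C \<and> (\<forall>\<pi>\<in>S. \<exists>B\<in>\<pi>. C \<subseteq> B)}"
  have single: "{a} \<in> F" if "a \<in> A" for a
  proof -
    have "\<exists>B\<in>\<pi>. {a} \<subseteq> B" if "\<pi> \<in> S" for \<pi>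
      using S[OF that] \<open>a \<in> A\<close> by (auto simp: partition_on_def)
    then show ?thesis using that valid_singleton by (simp add: F_def)
  qed
  have union: "C \<union> D \<in> F" if "C \<in> F" "D \<in> F" "C \<inter> D \<noteq> {}" for C D
  proof -
    have "\<exists>B\<in>\<pi>. C \<union> D \<subseteq> B" if pi: "\<pi> \<in> S" for \<pi>
    proof -
      obtain B where B: "B \<in> \<pi>" "C \<subseteq> B" using \<open>C \<in> F\<close> pi unfolding F_def by blast
      obtain B' where B': "B' \<in> \<pi>" "D \<subseteq> B'" using \<open>D \<in> F\<close> pi unfolding F_def by blast
      have "B = B'"
        using partition_on_same_block[OF S[OF pi] B(1) B'(1)] B(2) B'(2) \<open>C \<inter> D \<noteq> {}\<close> by blast
      with B B' show ?thesis by blast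
    qed
    then show ?thesis using that valid_union[of C D] by (simp add: F_def)
  qed
  have "F \<subseteq> Pow A" "{} \<notin> F" by (auto simp: F_def)
  obtain g where g: "partition_on A g" "g \<subseteq> F" "\<forall>C\<in>F. \<exists>D\<in>g. C \<subseteq> D"
    using maximal_members_partition[OF finite_ground \<open>F \<subseteq> Pow A\<close> \<open>{} \<notin> F\<close> single union] .
  show thesis
  proof
    show "g \<in> carrier block_poset" using g by (auto simp: carrier_block_poset F_def)
    show "\<forall>\<pi>\<in>S. refines A g \<pi>"
    proof
      fix \<pi> assume pi: "\<pi> \<in> S"
      have "\<forall>C\<in>g. \<exists>B\<in>\<pi>. C \<subseteq> B" using g(2) pi unfolding F_def by blast
      then show "refines A g \<pi>" using g(1) S[OF pi] by (simp add: refines_def)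
    qed
    show "\<forall>C\<subseteq>A. C \<noteq> {} \<longrightarrow> V C \<longrightarrow> (\<forall>\<pi>\<in>S. \<exists>B\<in>\<pi>. C \<subseteq> B) \<longrightarrow> (\<exists>D\<in>g. C \<subseteq> D)"
      using g(3) by (simp add: F_def)
  qed
qed

lemma carrier_block:
  assumes "\<pi> \<in> carrier block_poset" "B \<in> \<pi>"
  shows "B \<subseteq> A" "B \<noteq> {}" "V B"
  using assms by (auto simp: carrier_block_poset partition_on_def)

lemma greatest_lower_bound:
  assumes S: "\<And>\<pi>. \<pi> \<in> S \<Longrightarrow> partition_on A \<pi>"
  obtains g where "g \<in> carrier block_poset" "\<forall>\<pi>\<in>S. refines A g \<pi>"
    "\<forall>z\<in>carrier block_poset. (\<forall>\<pi>\<in>S. refines A z \<pi>) \<longrightarrow> refines A z g"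
proof -
  obtain g where g: "g \<in> carrier block_poset"
    "\<forall>\<pi>\<in>S. refines A g \<pi>"
    "\<forall>C\<subseteq>A. C \<noteq> {} \<longrightarrow> V C \<longrightarrow> (\<forall>\<pi>\<in>S. \<exists>B\<in>\<pi>. C \<subseteq> B) \<longrightarrow> (\<exists>D\<in>g. C \<subseteq> D)"
    using greatest_common_refinement[OF S] .
  have "refines A z g" if z: "z \<in> carrier block_poset" "\<forall>\<pi>\<in>S. refines A z \<pi>" for z
  proof -
    have "\<exists>D\<in>g. C \<subseteq> D" if "C \<in> z" for C
    proof -
      have "\<forall>\<pi>\<in>S. \<exists>B\<in>\<pi>. C \<subseteq> B" using z(2) that by (auto simp: refines_def)
      then show ?thesis using g(3) carrier_block[OF z(1) that] by blast
    qed
    then show ?thesis using z(1) g(1) by (simp add: refines_def carrier_block_poset)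
  qed
  then show thesis using that g(1,2) by blast
qed

lemma partial_order_block_poset: "partial_order block_poset"
proof (rule partial_orderI_equality)
  show "x = y" if "x \<sqsubseteq>\<^bsub>block_poset\<^esub> y" "y \<sqsubseteq>\<^bsub>block_poset\<^esub> x" for x y
    using that refines_asym by simp
  show "x \<sqsubseteq>\<^bsub>block_poset\<^esub> z" if "x \<sqsubseteq>\<^bsub>block_poset\<^esub> y" "y \<sqsubseteq>\<^bsub>block_poset\<^esub> z" for x y z
    using that refines_trans by simp
qed (simp_all add: carrier_block_poset refines_refl)

lemma lattice_block_poset: "lattice block_poset"
proof (rule latticeI_bounds[OF partial_order_block_poset])
  fix x y assume xy: "x \<in> carrier block_poset" "y \<in> carrier block_poset"
  \<comment> \<open>The join is obtained as the greatest lower bound of all common upper bounds;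
    \<open>x\<close> and \<open>y\<close> are lower bounds of \<open>?U\<close> and therefore lie
    below it.\<close>
  let ?U = "{z \<in> carrier block_poset. refines A x z \<and> refines A y z}"
  have "partition_on A \<pi>" if "\<pi> \<in> ?U" for \<pi> using that by (simp add: carrier_block_poset)
  then obtain s where "s \<in> carrier block_poset"
    "\<forall>\<pi>\<in>?U. refines A s \<pi>"
    "\<forall>z\<in>carrier block_poset. (\<forall>\<pi>\<in>?U. refines A z \<pi>) \<longrightarrow> refines A z s"
    by (rule greatest_lower_bound)
  with xy show "\<exists>s\<in>carrier block_poset. x \<sqsubseteq>\<^bsub>block_poset\<^esub> s \<and> y \<sqsubseteq>\<^bsub>block_poset\<^esub> s \<and>
      (\<forall>z\<in>carrier block_poset. x \<sqsubseteq>\<^bsub>block_poset\<^esub> z \<longrightarrow> y \<sqsubseteq>\<^bsub>block_poset\<^esub> z \<longrightarrow> s \<sqsubseteq>\<^bsub>block_poset\<^esub> z)"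
    by (intro bexI[of _ s]) auto
  have "partition_on A \<pi>" if "\<pi> \<in> {x, y}" for \<pi> using that xy by (auto simp: carrier_block_poset)
  then obtain i where "i \<in> carrier block_poset"
    "\<forall>\<pi>\<in>{x, y}. refines A i \<pi>"
    "\<forall>z\<in>carrier block_poset. (\<forall>\<pi>\<in>{x, y}. refines A z \<pi>) \<longrightarrow> refines A z i"
    by (rule greatest_lower_bound)
  then show "\<exists>s\<in>carrier block_poset. s \<sqsubseteq>\<^bsub>block_poset\<^esub> x \<and> s \<sqsubseteq>\<^bsub>block_poset\<^esub> y \<and>
      (\<forall>z\<in>carrier block_poset. z \<sqsubseteq>\<^bsub>block_poset\<^esub> x \<longrightarrow> z \<sqsubseteq>\<^bsub>block_poset\<^esub> y \<longrightarrow> z \<sqsubseteq>\<^bsub>block_poset\<^esub> s)"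
    by (intro bexI[of _ i]) auto
qed

section \<open>Left-modular coatoms of intervals\<close>

lemma interval_left_modular_coatom:
  assumes u: "u \<in> carrier block_poset" and v: "v \<in> carrier block_poset"
    and uv: "refines A u v" "u \<noteq> v"
  shows "\<exists>m. coatom (subposet block_poset \<lbrace>u..v\<rbrace>\<^bsub>block_poset\<^esub>) m \<and>
    left_modular (subposet block_poset \<lbrace>u..v\<rbrace>\<^bsub>block_poset\<^esub>) m"
    (is "\<exists>m. coatom ?I m \<and> left_modular ?I m")
proof -
  have part: "partition_on A \<pi>" if "\<pi> \<in> carrier block_poset" for \<pi>
    using that by (simp add: carrier_block_poset)
  have I: "x \<in> carrier ?I \<longleftrightarrow> x \<in> carrier block_poset \<and> refines A u x \<and> refines A x v" for x
    by (auto simp: at_least_at_most_def)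
  obtain B where B: "B \<in> v" "B \<notin> u"
  proof -
    have "\<not> v \<subseteq> u"
    proof
      assume "v \<subseteq> u"
      then have "\<forall>C\<in>v. \<exists>D\<in>u. C \<subseteq> D" by blast
      then have "refines A v u" using part u v by (simp add: refines_def)
      with uv show False by (metis refines_asym)
    qed
    then show thesis using that by blast
  qed
  let ?\<U> = "{W \<in> u. W \<subseteq> B}"
  have "partition_on B ?\<U>" by (rule refines_obtains_subset[OF uv(1) B(1)])
  moreover have "V W" if "W \<in> ?\<U>" for W using that carrier_block(3)[OF u] by simp
  ultimately have "\<exists>U\<in>?\<U>. \<forall>\<Y> X. \<Y> \<subseteq> ?\<U> \<longrightarrow> U \<subset> X \<longrightarrow> X \<subset> \<Union>\<Y> \<longrightarrow>
      V X \<longrightarrow> V (\<Union>\<Y>) \<longrightarrow> V (\<Union>\<Y> - U)"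
    by (rule removable[OF carrier_block(1,2)[OF v B(1)]])
  then obtain U where "U \<in> ?\<U>" and rem: "\<forall>\<Y> X. \<Y> \<subseteq> ?\<U> \<longrightarrow> U \<subset> X \<longrightarrow> X \<subset> \<Union>\<Y> \<longrightarrow>
      V X \<longrightarrow> V (\<Union>\<Y>) \<longrightarrow> V (\<Union>\<Y> - U)"
    by (rule bexE)
  then have U: "U \<in> u" "U \<subseteq> B" by simp_all
  then have UB: "U \<subset> B" using B(2) by (metis psubsetI)
  have UA: "U \<noteq> {}" "U \<subset> A" using UB carrier_block[OF u U(1)] carrier_block(1)[OF v B(1)] by auto
  \<comment> \<open>Refining this partition means that no block crosses the border of
    \<open>U\<close>. Hence \<open>m\<close> is taken as the greatest partition into valid blocks
    that refines both it and \<open>v\<close>.\<close>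
  have split_part: "partition_on A {U, A - U}"
    using UA by (auto simp: partition_on_def disjoint_def)
  have "partition_on A \<pi>" if "\<pi> \<in> {v, {U, A - U}}" for \<pi> using that part[OF v] split_part by auto
  then obtain m where m: "m \<in> carrier block_poset"
      "\<forall>\<pi>\<in>{v, {U, A - U}}. refines A m \<pi>"
    and m_max: "\<forall>C\<subseteq>A. C \<noteq> {} \<longrightarrow> V C \<longrightarrow>
      (\<forall>\<pi>\<in>{v, {U, A - U}}. \<exists>B\<in>\<pi>. C \<subseteq> B) \<longrightarrow> (\<exists>D\<in>m. C \<subseteq> D)"
    by (rule greatest_common_refinement)
  have mv: "refines A m v" and mU: "refines A m {U, A - U}" using m(2) by auto
  have m_block: "\<exists>D\<in>m. C \<subseteq> D"
    if "C \<subseteq> A" "C \<noteq> {}" "V C" "\<exists>D\<in>v. C \<subseteq> D" "C \<subseteq> U \<or> C \<inter> U = {}" for C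
    using that by (intro m_max[rule_format]) auto
  \<comment> \<open>Once \<open>U\<close> is a block of \<open>x\<close>, every other block of
    \<open>x\<close> misses \<open>U\<close>, so \<open>m_block\<close> applies to each. With
    \<open>x = u\<close> this puts \<open>m\<close> into the interval.\<close>
  have below_m: "refines A x m" if x: "x \<in> carrier block_poset" "refines A x v" "U \<in> x" for x
  proof -
    have "\<exists>D\<in>m. C \<subseteq> D" if C: "C \<in> x" for C
    proof (rule m_block)
      show "C \<subseteq> U \<or> C \<inter> U = {}" using partition_on_same_block[OF part[OF x(1)] C x(3)] by blast
    qed (use carrier_block[OF x(1) C] refines_subset_block[OF x(2) C subset_refl] in blast)+
    then show ?thesis using part x m by (simp add: refines_def)
  qed
  have m_I: "m \<in> carrier ?I" using I m(1) mv below_m[OF u uv(1) U(1)] by blast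
  have "m \<noteq> v"
  proof
    assume "m = v"
    then have "B \<subseteq> U \<or> B \<subseteq> A - U" using refines_subset_block[OF mU _ subset_refl, of B] B(1) by simp
    then show False using UB UA(1) by blast
  qed
  \<comment> \<open>This is the hypothesis \<open>split\<close> of
    \<open>left_modular_coatomI\<close>; the witness \<open>w\<close> is the meet of
    \<open>m\<close> and \<open>y\<close>.\<close>
  moreover have "\<exists>w\<in>carrier ?I. refines A w m \<and> refines A w y \<and>
      (\<forall>z\<in>carrier ?I. refines A x z \<longrightarrow> refines A w z \<longrightarrow> refines A y z)"
    if x: "x \<in> carrier ?I" and y: "y \<in> carrier ?I" and xy: "refines A x y" and xm: "\<not> refines A x m"
    for x y
  proof -
    have xc: "x \<in> carrier block_poset" "refines A u x" "refines A x v"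
      and yc: "y \<in> carrier block_poset" "refines A u y" "refines A y v"
      using x y I by auto
    have "U \<notin> x" using below_m xc xm by blast
    then obtain X where X: "X \<in> x" "U \<subset> X" using refines_subset_block[OF xc(2) U(1) subset_refl] by (metis psubsetI)
    obtain Y where Y: "Y \<in> y" "X \<subseteq> Y" using refines_subset_block[OF xy X(1) subset_refl] by blast
    have "partition_on A \<pi>" if "\<pi> \<in> {m, y}" for \<pi> using that part m(1) yc(1) by auto
    then obtain w where w: "w \<in> carrier block_poset"
        "\<forall>\<pi>\<in>{m, y}. refines A w \<pi>"
      and w_max: "\<forall>C\<subseteq>A. C \<noteq> {} \<longrightarrow> V C \<longrightarrow>
        (\<forall>\<pi>\<in>{m, y}. \<exists>B\<in>\<pi>. C \<subseteq> B) \<longrightarrow> (\<exists>D\<in>w. C \<subseteq> D)"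
      by (rule greatest_common_refinement)
    have wm: "refines A w m" and wy: "refines A w y" using w(2) by auto
    have w_block: "\<exists>D\<in>w. C \<subseteq> D"
      if "C \<subseteq> A" "C \<noteq> {}" "V C" "\<exists>D\<in>m. C \<subseteq> D" "\<exists>D\<in>y. C \<subseteq> D" for C
      using that by (intro w_max[rule_format]) auto
    \<comment> \<open>Used twice: for the blocks of \<open>y\<close> other than \<open>Y\<close>,
      and for \<open>Y - U\<close> once that set is known to be valid.\<close>
    have split_block: "\<exists>D\<in>w. C \<subseteq> D"
      if C: "C \<noteq> {}" "V C" "E \<in> y" "C \<subseteq> E" "C \<inter> U = {}" for C E
    proof -
      have CA: "C \<subseteq> A" using carrier_block(1)[OF yc(1) C(3)] C(4) by blast
      have "\<exists>D\<in>v. C \<subseteq> D" by (rule refines_subset_block[OF yc(3) C(3,4)])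
      then have "\<exists>D\<in>m. C \<subseteq> D" using m_block[OF CA C(1,2)] C(5) by blast
      then show ?thesis using w_block[OF CA C(1,2)] C(3,4) by blast
    qed
    have "refines A u w"
    proof -
      have "\<exists>D\<in>w. C \<subseteq> D" if C: "C \<in> u" for C
        using w_block[OF carrier_block[OF u C]] refines_subset_block[OF yc(2) C subset_refl]
          refines_subset_block[OF below_m[OF u uv(1) U(1)] C subset_refl] by blast
      then show ?thesis using part u w by (simp add: refines_def)
    qed
    then have "w \<in> carrier ?I" using I w(1) refines_trans[OF wy yc(3)] by blast
    moreover have "refines A y z" if z: "z \<in> carrier ?I" "refines A x z" "refines A w z" for z
    proof -
      have zp: "partition_on A z" using z I part by blast
      have "\<exists>D\<in>z. E \<subseteq> D" if E: "E \<in> y" for E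
      proof (cases "E = Y")
        case False
        then have "E \<inter> U = {}"
          using partition_on_same_block[OF part[OF yc(1)] E Y(1)] X(2) Y(2) by blast
        then obtain D where "D \<in> w" "E \<subseteq> D"
          using split_block[OF carrier_block(2,3)[OF yc(1) E] E] by blast
        then show ?thesis by (rule refines_subset_block[OF z(3)])
      next
        \<comment> \<open>\<open>X\<close> lies in a block of \<open>z\<close> because
          \<open>x\<close> refines \<open>z\<close>, and \<open>Y - U\<close> lies in one because
          \<open>w\<close> does. As \<open>U \<subset> X\<close>, the two sets overlap when
          \<open>X \<noteq> Y\<close>, so a single block of \<open>z\<close> contains their union
          \<open>Y\<close>.\<close>
        case True
        obtain D where D: "D \<in> z" "X \<subseteq> D" using refines_subset_block[OF z(2) X(1) subset_refl] by blast
        show ?thesis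
        proof (cases "X = Y")
          case True
          with D \<open>E = Y\<close> show ?thesis by blast
        next
          case False
          \<comment> \<open>These blocks fill \<open>Y\<close> since \<open>u\<close> refines
            \<open>y\<close>. They belong to \<open>?\<U>\<close> because the block of
            \<open>v\<close> containing \<open>Y\<close> shares the nonempty \<open>U\<close> with
            \<open>B\<close> and is therefore \<open>B\<close>.\<close>
          let ?\<Y> = "{W \<in> u. W \<subseteq> Y}"
          obtain B' where B': "B' \<in> v" "Y \<subseteq> B'" using refines_subset_block[OF yc(3) Y(1) subset_refl] by blast
          have "B' = B"
            using partition_on_same_block[OF part[OF v] B'(1) B(1)] B'(2) Y(2) X(2) UB UA(1) by blast
          then have "?\<Y> \<subseteq> ?\<U>" using B' by blast
          moreover have YY: "\<Union>?\<Y> = Y"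
            using refines_obtains_subset[OF yc(2) Y(1)] by (simp add: partition_on_def)
          ultimately have "V (Y - U)"
            using rem[rule_format, of ?\<Y> X] X(2) Y(2) False
              carrier_block(3)[OF xc(1) X(1)] carrier_block(3)[OF yc(1) Y(1)]
            by (metis psubsetI)
          then obtain D' where "D' \<in> w" "Y - U \<subseteq> D'"
            using split_block[of "Y - U" Y] Y X(2) by blast
          then obtain D'' where D'': "D'' \<in> z" "Y - U \<subseteq> D''"
            using refines_subset_block[OF z(3)] by blast
          have "D'' = D"
            using partition_on_same_block[OF zp D''(1) D(1)] D''(2) D(2) X(2) Y(2) by blast
          then show ?thesis using D D'' X(2) \<open>E = Y\<close> by blast
        qed
      qed
      then show ?thesis using zp part yc(1) by (simp add: refines_def)
    qed
    ultimately show ?thesis using wm wy by blast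
  qed
  moreover have "v \<in> carrier ?I" using I v uv part refines_refl by blast
  ultimately have "coatom ?I m \<and> left_modular ?I m"
    using left_modular_coatomI[OF lattice_interval[OF lattice_block_poset u v], of v m] m_I I
    by simp
  then show ?thesis by blast
qed

theorem comodernistic_block_poset: "comodernistic block_poset"
  unfolding comodernistic_def lless_def
  using lattice_block_poset interval_left_modular_coatom by simp

end

section \<open>The universal and existential conditions as block systems\<close>

lemma max_singleton_or_no_singleton:
  fixes f :: "'a \<Rightarrow> nat"
  assumes "finite B" "B \<noteq> {}" "partition_on B \<U>"
  obtains (singleton) a where "{a} \<in> \<U>" "\<And>b. {b} \<in> \<U> \<Longrightarrow> f b \<le> f a"
    | (no_singleton) U where "U \<in> \<U>" "\<And>b. {b} \<notin> \<U>"
proof (cases "\<exists>b. {b} \<in> \<U>")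
  case True
  have "{b. {b} \<in> \<U>} \<subseteq> B" using assms(3) by (auto simp: partition_on_def)
  then have fin: "finite {b. {b} \<in> \<U>}" using assms(1) by (rule finite_subset)
  let ?S = "f ` {b. {b} \<in> \<U>}"
  have "Max ?S \<in> ?S" using fin True by (intro Max_in) auto
  then obtain a where "{a} \<in> \<U>" "f a = Max ?S" by auto
  moreover have "f b \<le> Max ?S" if "{b} \<in> \<U>" for b using fin that by (intro Max_ge) auto
  ultimately show ?thesis using singleton by metis
next
  case False
  obtain U where "U \<in> \<U>" using assms(2,3) by (auto simp: partition_on_def)
  with False show ?thesis using no_singleton by blast
qed

lemma partition_block_in_Union_diff:
  assumes "partition_on B \<U>" "\<Y> \<subseteq> \<U>" "U \<in> \<U>" "y \<in> \<Union>\<Y> - U"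
  obtains W where "W \<in> \<U>" "y \<in> W" "W \<subseteq> \<Union>\<Y> - U"
proof -
  obtain W where W: "W \<in> \<Y>" "y \<in> W" using assms(4) by blast
  then have "W \<inter> U = {}"
    using partition_on_same_block[OF assms(1), of W U] assms by blast
  with W assms(2) show thesis using that by blast
qed

text \<open>Let \<open>y\<close> lie in \<open>\<Union>\<Y> - U\<close>. If its block
  \<open>W\<close> in \<open>\<U>\<close> is not a singleton, then \<open>W\<close> survives the
  removal of \<open>U\<close> and \<open>f y \<le> card W\<close>. If \<open>{y}\<close> is a block,
  then \<open>U = {a}\<close> with \<open>f a\<close> maximal, and
  \<open>f y \<le> f a \<le> card X\<close> by validity of \<open>X\<close>.\<close>

lemma block_system_all:
  fixes f :: "'a \<Rightarrow> nat"
  assumes fin: "finite A"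
  shows "block_system A (\<lambda>B. card B \<noteq> 1 \<longrightarrow> (\<forall>x\<in>B. f x \<le> card B))" (is "block_system A ?V")
proof
  show "finite A" by fact
  show "?V {a}" for a by simp
  show "?V (S \<union> T)" if "S \<subseteq> A" "T \<subseteq> A" "?V S" "?V T" "S \<inter> T \<noteq> {}" for S T
  proof (cases "card S = 1 \<or> card T = 1")
    case True
    then obtain a where "S = {a} \<or> T = {a}" by (metis card_1_singletonE)
    then have "S \<union> T = S \<or> S \<union> T = T" using \<open>S \<inter> T \<noteq> {}\<close> by auto
    then show ?thesis using that by metis
  next
    case False
    have "finite (S \<union> T)" using that fin by (meson finite_Un finite_subset)
    then have "card S \<le> card (S \<union> T)" "card T \<le> card (S \<union> T)" by (auto intro: card_mono)
    then show ?thesis using that False by (auto intro: order_trans)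
  qed
  fix B \<U> assume B: "B \<subseteq> A" "B \<noteq> {}" and part: "partition_on B \<U>" and V: "\<And>W. W \<in> \<U> \<Longrightarrow> ?V W"
  have finB: "finite B" using B fin finite_subset by blast
  have finY: "finite (\<Union>\<Y>)" if "\<Y> \<subseteq> \<U>" for \<Y>
    using that part by (intro finite_subset[OF _ finB]) (auto simp: partition_on_def)
  have big: "f y \<le> card (\<Union>\<Y> - U)"
    if Y: "\<Y> \<subseteq> \<U>" "U \<in> \<U>" "y \<in> \<Union>\<Y> - U" "{y} \<notin> \<U>" for \<Y> U y
  proof -
    obtain W where W: "W \<in> \<U>" "y \<in> W" "W \<subseteq> \<Union>\<Y> - U"
      using partition_block_in_Union_diff[OF part Y(1-3)] .
    then have "card W \<noteq> 1" using Y(4) by (metis card_1_singletonE singletonD)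
    then have "f y \<le> card W" using V[OF W(1)] W(2) by blast
    also have "\<dots> \<le> card (\<Union>\<Y> - U)" using W(3) finY[OF Y(1)] by (intro card_mono) auto
    finally show ?thesis .
  qed
  show "\<exists>U\<in>\<U>. \<forall>\<Y> X. \<Y> \<subseteq> \<U> \<longrightarrow> U \<subset> X \<longrightarrow> X \<subset> \<Union>\<Y> \<longrightarrow> ?V X \<longrightarrow> ?V (\<Union>\<Y>) \<longrightarrow> ?V (\<Union>\<Y> - U)"
    using finB B(2) part
  proof (cases rule: max_singleton_or_no_singleton[where f = f])
    case (singleton a)
    have rem: "f y \<le> card (\<Union>\<Y> - {a})"
      if Y: "\<Y> \<subseteq> \<U>" "{a} \<subset> X" "X \<subset> \<Union>\<Y>" "?V X" "y \<in> \<Union>\<Y> - {a}" for \<Y> X y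
    proof (cases "{y} \<in> \<U>")
      case True
      have "f y \<le> f a" using singleton(2) True .
      also have "f a \<le> card X" using Y(2,4) by (blast elim: card_1_singletonE)
      \<comment> \<open>The strict inclusion of \<open>X\<close> in \<open>\<Union>\<Y>\<close> pays
        for the removed point \<open>a\<close>.\<close>
      also have "card X \<le> card (\<Union>\<Y> - {a})"
        using psubset_card_mono[OF finY[OF Y(1)] Y(3)] Y(2,3) by (subst card_Diff_singleton) auto
      finally show ?thesis .
    qed (use big singleton(1) Y in blast)
    show ?thesis
      by (intro bexI[of _ "{a}"] allI impI ballI, rule rem) (assumption | rule singleton)+
  next
    case (no_singleton U)
    show ?thesis
      by (intro bexI[of _ U] allI impI ballI, rule big) (assumption | rule no_singleton)+
  qed
qed

text \<open>One good element of \<open>\<Union>\<Y> - U\<close> suffices. A non-singleton block of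
  \<open>\<U>\<close> inside this set supplies its own; if there is none, \<open>X\<close> supplies
  one, with a replacement when its good element is the removed \<open>a\<close>.\<close>

lemma block_system_ex:
  fixes f :: "'a \<Rightarrow> nat"
  assumes fin: "finite A"
  shows "block_system A (\<lambda>B. card B \<noteq> 1 \<longrightarrow> (\<exists>x\<in>B. f x \<le> card B))" (is "block_system A ?V")
proof
  show "finite A" by fact
  show "?V {a}" for a by simp
  show "?V (S \<union> T)" if "S \<subseteq> A" "T \<subseteq> A" "?V S" "?V T" "S \<inter> T \<noteq> {}" for S T
  \<comment> \<open>Splitting on \<open>S\<close> alone is enough: a good element of
    \<open>S\<close> remains good in the larger union, and a singleton \<open>S\<close> is absorbed
    by \<open>T\<close>.\<close>
  proof (cases "card S = 1")
    case True
    then obtain a where "S = {a}" by (metis card_1_singletonE)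
    then have "S \<union> T = T" using \<open>S \<inter> T \<noteq> {}\<close> by auto
    then show ?thesis using that by metis
  next
    case False
    have "finite (S \<union> T)" using that fin by (meson finite_Un finite_subset)
    then have "card S \<le> card (S \<union> T)" by (auto intro: card_mono)
    then show ?thesis using that(3) False by (meson UnI1 order_trans)
  qed
  fix B \<U> assume B: "B \<subseteq> A" "B \<noteq> {}" and part: "partition_on B \<U>" and V: "\<And>W. W \<in> \<U> \<Longrightarrow> ?V W"
  have finB: "finite B" using B fin finite_subset by blast
  have finY: "finite (\<Union>\<Y>)" if "\<Y> \<subseteq> \<U>" for \<Y>
    using that part by (intro finite_subset[OF _ finB]) (auto simp: partition_on_def)
  have big: "\<exists>x\<in>\<Union>\<Y> - U. f x \<le> card (\<Union>\<Y> - U)"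
    if Y: "\<Y> \<subseteq> \<U>" "U \<in> \<U>" "y \<in> \<Union>\<Y> - U" "{y} \<notin> \<U>" for \<Y> U y
  proof -
    obtain W where W: "W \<in> \<U>" "y \<in> W" "W \<subseteq> \<Union>\<Y> - U"
      using partition_block_in_Union_diff[OF part Y(1-3)] .
    then have "card W \<noteq> 1" using Y(4) by (metis card_1_singletonE singletonD)
    then obtain x where x: "x \<in> W" "f x \<le> card W" using V[OF W(1)] by blast
    have "card W \<le> card (\<Union>\<Y> - U)" using W(3) finY[OF Y(1)] by (intro card_mono) auto
    then show ?thesis using x W(3) by (meson order_trans subsetD)
  qed
  show "\<exists>U\<in>\<U>. \<forall>\<Y> X. \<Y> \<subseteq> \<U> \<longrightarrow> U \<subset> X \<longrightarrow> X \<subset> \<Union>\<Y> \<longrightarrow> ?V X \<longrightarrow> ?V (\<Union>\<Y>) \<longrightarrow> ?V (\<Union>\<Y> - U)"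
    using finB B(2) part
  proof (cases rule: max_singleton_or_no_singleton[where f = f])
    case (singleton a)
    have rem: "\<exists>x\<in>\<Union>\<Y> - {a}. f x \<le> card (\<Union>\<Y> - {a})"
      if Y: "\<Y> \<subseteq> \<U>" "{a} \<subset> X" "X \<subset> \<Union>\<Y>" "?V X" for \<Y> X
    proof (cases "\<forall>y\<in>\<Union>\<Y> - {a}. {y} \<in> \<U>")
      case all_single: True
      have le: "card X \<le> card (\<Union>\<Y> - {a})"
        using psubset_card_mono[OF finY[OF Y(1)] Y(3)] Y(2,3) by (subst card_Diff_singleton) auto
      obtain x where x: "x \<in> X" "f x \<le> card X" using Y(2,4) by (blast elim: card_1_singletonE)
      obtain b where b: "b \<in> X" "b \<noteq> a" using Y(2) by blast
      obtain c where "c \<in> X - {a}" "f c \<le> card X"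
      \<comment> \<open>If the good element of \<open>X\<close> is \<open>a\<close> itself, any
        other \<open>b\<close> in \<open>X\<close> replaces it: \<open>{b}\<close> is a block, so
        maximality gives \<open>f b \<le> f a \<le> card X\<close>.\<close>
      proof (cases "x = a")
        case True
        have "f b \<le> f a" using singleton(2) all_single b Y(3) by blast
        with True x b show thesis using that[of b] by simp
      qed (use x that in blast)
      then show ?thesis using le Y(3) by (intro bexI[of _ c]) auto
    qed (use big singleton(1) Y in blast)
    show ?thesis
      by (intro bexI[of _ "{a}"] allI impI, rule rem) (assumption | rule singleton)+
  next
    case (no_singleton U)
    have rem: "\<exists>x\<in>\<Union>\<Y> - U. f x \<le> card (\<Union>\<Y> - U)" if Y: "\<Y> \<subseteq> \<U>" "U \<subset> X" "X \<subset> \<Union>\<Y>" for \<Y> X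
    proof -
      \<comment> \<open>Such a \<open>y\<close> exists since
        \<open>U \<subset> X \<subset> \<Union>\<Y>\<close>; its block is not a singleton, so
        \<open>big\<close> applies.\<close>
      obtain y where "y \<in> \<Union>\<Y> - U" using Y(2,3) by blast
      then show ?thesis using big[OF Y(1) no_singleton(1)] no_singleton(2) by blast
    qed
    show ?thesis
      by (intro bexI[of _ U] allI impI, rule rem) (assumption | rule no_singleton)+
  qed
qed

theorem theorem6p3:
  fixes n :: nat and aff :: "nat \<Rightarrow> nat"
  assumes "n \<ge> 1" and "aff \<in> {1..n} \<rightarrow> {1..n}"
  shows "comodernistic (Pi_exists n aff) \<and> comodernistic (Pi_forall n aff)"
proof
  interpret ex: block_system "{1..n}" "\<lambda>B. card B \<noteq> 1 \<longrightarrow> (\<exists>x\<in>B. aff x \<le> card B)"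
    by (rule block_system_ex) simp
  \<comment> \<open>The two sides are the same record after unfolding, with validity as the
    condition on blocks.\<close>
  have "Pi_exists n aff = ex.block_poset"
    unfolding ex.block_poset_def by (simp add: Pi_exists_def partition_lattice_def subposet_def)
  then show "comodernistic (Pi_exists n aff)"
    using ex.comodernistic_block_poset by simp
  interpret all: block_system "{1..n}" "\<lambda>B. card B \<noteq> 1 \<longrightarrow> (\<forall>x\<in>B. aff x \<le> card B)"
    by (rule block_system_all) simp
  have "Pi_forall n aff = all.block_poset"
    unfolding all.block_poset_def by (simp add: Pi_forall_def partition_lattice_def subposet_def)
  then show "comodernistic (Pi_forall n aff)"
    using all.comodernistic_block_poset by simp
qed

end
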